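(* For the online algorithm described in the context, whether its non-isolated part uses MNF or MFF, the approximation factor $(3,1.7)$ is tight: for every $\delta>0$ there are a choice of $\varepsilon=2^{-j}$ and instances with all item sizes at least $\varepsilon$ and arbitrarily large $\mathrm{OPT}(I)$ on which the algorithm uses at least $(3-\delta)\mathrm{OPT}(I)$ bins, and there are instances containing a colour $c$ with arbitrarily large $\mathrm{OPT}(I_c)$ on which $P_c(I)\ge(1.7-\delta)\mathrm{OPT}(I_c)$.
   Context: Online coloured bin packing: items arrive one by one, each with size $s(e)\in[\varepsilon,1]$ and colour $c(e)\in\{1,\dots,m\}$, placed irrevocably into unit-capacity bins. $I_c$ is the set of colour-$c$ items; $\mathrm{OPT}(I)$, $\mathrm{OPT}(I_c)$ are offline minimum numbers of bins for $I$, $I_c$; $P(I)$ is the number of bins used and $P_c(I)$ the number of bins containing a colour-$c$ item. Here $\varepsilon=2^{-j}$, $j$ a positive integer. For $i=1,\dots,j$, a level-$i$ bin is divided into exactly $1/(2^i\varepsilon)$ regions each of size $2^i\varepsilon$ (level-$i$ regions); each region contains items of at most one colour. Modified Next Fit (MNF) packs item $e$ of colour $c$: let $i$ be the highest level at which an item of colour $c$ is packed ($i=1$ for the first item of $c$); if $e$ fits in colour $c$'s level-$i$ region, pack it there; otherwise let $l>i$ be the lowest level with $2^l\varepsilon\ge s(e)$ and pack $e$ into a new level-$l$ region (creating a new level-$l$ bin if needed). Modified First Fit (MFF) is identical except that $i$ is taken to be the lowest level whose region occupied by colour $c$ has space for $e$ (so $e$ is tried in each region already used by $c$). A colour has level $i$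 if $i$ is the largest level of a bin containing its items. The algorithm packs an item of colour $c$ with MNF (resp. MFF) into these non-isolated bins while $c$ has level $<j$, and otherwise with Bounded Best-Fit (at most 2 open bins; best fit among open bins, else close the fullest open bin and open a new one) into isolated bins containing only colour $c$ (the last level-$j$ bin of $c$ also counts as isolated). *)

theory Defs
  imports Complex_Main
begin

record item =
  sz :: real
  col :: nat

definition eps :: "nat \<Rightarrow> real" where
  "eps j = 1 / 2 ^ j"

text \<open>An instance is the list of items in order of arrival; its colours are \<open>1, \<dots>, m\<close>.\<close>

definition valid_instance :: "nat \<Rightarrow> nat \<Rightarrow> item list \<Rightarrow> bool" where
  "valid_instance m j I \<longleftrightarrow> (\<forall>e\<in>set I. eps j \<le> sz e \<and> sz e \<le> 1 \<and> col e \<in> {1..m})"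

definition items_of_colour :: "nat \<Rightarrow> item list \<Rightarrow> item list" where
  "items_of_colour c I = filter (\<lambda>e. col e = c) I"

definition OPT :: "item list \<Rightarrow> nat" where
  "OPT I = (LEAST k. \<exists>f :: nat \<Rightarrow> nat.
      (\<forall>i<length I. f i < k) \<and>
      (\<forall>b<k. (\<Sum>i | i < length I \<and> f i = b. sz (I ! i)) \<le> 1))"

text \<open>
  A region is the list of the items packed into it.  A bin stores its level and the regions that
  are already in use; a level \<open>i\<close> bin offers \<open>1 / (2 ^ i * eps j) = 2 ^ (j - i)\<close>
  regions of size \<open>2 ^ i * eps j\<close>.  An isolated bin is represented as a level \<open>j\<close> bin,
  that is, a bin with one region of size 1.
\<close>

type_synonym region = "item list"

record bin =
  lev :: nat
  regs :: "region list"

definition load :: "region \<Rightarrow> real" where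
  "load R = sum_list (map sz R)"

definition bin_load :: "bin \<Rightarrow> real" where
  "bin_load b = sum_list (map load (regs b))"

definition contains_colour :: "bin \<Rightarrow> nat \<Rightarrow> bool" where
  "contains_colour b c \<longleftrightarrow> (\<exists>R\<in>set (regs b). \<exists>e\<in>set R. col e = c)"

text \<open>
  Bins are listed in the order in which they were opened and are referred to by their index;
  \<open>opens S c\<close> is the set of the open isolated bins of colour \<open>c\<close>.
\<close>

record state =
  bins :: "bin list"
  opens :: "nat \<Rightarrow> nat set"

definition empty_state :: state where
  "empty_state = \<lparr>bins = [], opens = (\<lambda>_. {})\<rparr>"

text \<open>
  The level of a colour is 0 as long as none of its items has arrived.  For the first item of a
  colour, the lowest sufficient level above 0 is then level 1 if the item fits into a level 1
  region, and the lowest sufficient level above 1 otherwise.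
\<close>

definition colour_level :: "state \<Rightarrow> nat \<Rightarrow> nat" where
  "colour_level S c = Max (insert 0 (lev ` {b \<in> set (bins S). contains_colour b c}))"

definition put :: "item \<Rightarrow> nat \<Rightarrow> nat \<Rightarrow> state \<Rightarrow> state" where
  "put e b r S =
    (let B = bins S ! b
     in S\<lparr>bins := (bins S)[b := B\<lparr>regs := (regs B)[r := (regs B ! r) @ [e]]\<rparr>]\<rparr>)"

text \<open>Region \<open>r\<close> of bin \<open>b\<close> is a level \<open>i\<close> region of the colour of \<open>e\<close> with enough
  space for \<open>e\<close>.\<close>

definition fits_in :: "nat \<Rightarrow> state \<Rightarrow> item \<Rightarrow> nat \<Rightarrow> nat \<times> nat \<Rightarrow> bool" where
  "fits_in j S e i = (\<lambda>(b, r).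
     b < length (bins S) \<and> lev (bins S ! b) = i \<and> r < length (regs (bins S ! b)) \<and>
     (\<exists>e'\<in>set (regs (bins S ! b) ! r). col e' = col e) \<and>
     load (regs (bins S ! b) ! r) + sz e \<le> 2 ^ i * eps j)"

definition fits_level :: "nat \<Rightarrow> state \<Rightarrow> item \<Rightarrow> nat \<Rightarrow> bool" where
  "fits_level j S e i \<longleftrightarrow> (\<exists>p. fits_in j S e i p)"

definition new_region :: "nat \<Rightarrow> state \<Rightarrow> item \<Rightarrow> nat \<Rightarrow> state" where
  "new_region j S e l =
    (let free = (\<lambda>b. b < length (bins S) \<and> lev (bins S ! b) = l \<and>
                      length (regs (bins S ! b)) < 2 ^ (j - l))
     in if \<exists>b. free b
        then (let b = (LEAST b. free b); B = bins S ! b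
              in S\<lparr>bins := (bins S)[b := B\<lparr>regs := regs B @ [[e]]\<rparr>]\<rparr>)
        else S\<lparr>bins := bins S @ [\<lparr>lev = l, regs = [[e]]\<rparr>]\<rparr>)"

datatype variant = MNF | MFF

text \<open>If no region of the colour has space for the item, MFF continues from the highest level
  of the colour, as MNF does.\<close>

fun start_level :: "variant \<Rightarrow> nat \<Rightarrow> state \<Rightarrow> item \<Rightarrow> nat" where
  "start_level MNF j S e = colour_level S (col e)"
| "start_level MFF j S e =
    (if \<exists>i. fits_level j S e i then (LEAST i. fits_level j S e i)
     else colour_level S (col e))"

text \<open>A level \<open>j\<close> bin counts as isolated, so it becomes the first open bin of its colour.\<close>

definition pack_non_isolated :: "variant \<Rightarrow> nat \<Rightarrow> state \<Rightarrow> item \<Rightarrow> state" where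
  "pack_non_isolated v j S e =
    (let i = start_level v j S e
     in if fits_level j S e i
        then (let (b, r) = (SOME p. fits_in j S e i p) in put e b r S)
        else (let l = (LEAST l. i < l \<and> sz e \<le> 2 ^ l * eps j);
                  T = new_region j S e l
              in if l = j then T\<lparr>opens := (opens S)(col e := {length (bins S)})\<rparr> else T))"

text \<open>
  Bounded Best-Fit with two open bins.  A bin is closed only if two bins are open.
  Ties between equally full bins are left to the unspecified choice made by \<open>ARG_MAX\<close>.
\<close>

definition pack_isolated :: "nat \<Rightarrow> state \<Rightarrow> item \<Rightarrow> state" where
  "pack_isolated j S e =
    (let Op = opens S (col e);
         F = {k \<in> Op. bin_load (bins S ! k) + sz e \<le> 1}
     in if F \<noteq> {}
        then put e (ARG_MAX (\<lambda>k. bin_load (bins S ! k)) k. k \<in> F) 0 S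
        else (let Op' = (if card Op < 2 then Op
                         else Op - {ARG_MAX (\<lambda>k. bin_load (bins S ! k)) k. k \<in> Op})
              in \<lparr>bins = bins S @ [\<lparr>lev = j, regs = [[e]]\<rparr>],
                  opens = (opens S)(col e := insert (length (bins S)) Op')\<rparr>))"

definition pack_item :: "variant \<Rightarrow> nat \<Rightarrow> state \<Rightarrow> item \<Rightarrow> state" where
  "pack_item v j S e =
    (if colour_level S (col e) < j then pack_non_isolated v j S e else pack_isolated j S e)"

definition packing :: "variant \<Rightarrow> nat \<Rightarrow> item list \<Rightarrow> state" where
  "packing v j I = foldl (pack_item v j) empty_state I"

definition bins_used :: "variant \<Rightarrow> nat \<Rightarrow> item list \<Rightarrow> nat" where
  "bins_used v j I = length (bins (packing v j I))"

definition bins_used_colour :: "variant \<Rightarrow> nat \<Rightarrow> nat \<Rightarrow> item list \<Rightarrow> nat" where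
  "bins_used_colour v j c I =
    card {b. b < length (bins (packing v j I)) \<and> contains_colour (bins (packing v j I) ! b) c}"

end

theory Submission
  imports Defs "HOL-Library.Multiset"
begin

text \<open>
  Factor 3: give each of many colours an item of size \<open>\<epsilon>\<close> followed by one of size
  \<open>\<epsilon> + \<epsilon>\<^sup>2\<close>.  Regions of sizes \<open>2\<epsilon>\<close> and \<open>4\<epsilon>\<close> are reserved for them, whereas
  offline the items of \<open>1 / (2\<epsilon>) - 1\<close> colours share a bin.

  Factor 1.7: a single item of size 1 makes its colour isolated at once.  Afterwards the items of
  the classical First Fit lower bound arrive, of sizes close to 1/6, 1/3 and 1/2, perturbed so that
  five, two and one of them block a bin for everything that follows, while offline almost all bins
  contain one item of each kind.  Since blocked bins never receive another item, it does not
  matter which of them Bounded Best-Fit closes.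
\<close>

section \<open>Offline packings\<close>

definition offline_packing :: "item list \<Rightarrow> nat \<Rightarrow> (nat \<Rightarrow> nat) \<Rightarrow> bool" where
  "offline_packing I k f \<longleftrightarrow> (\<forall>i<length I. f i < k) \<and>
      (\<forall>b<k. (\<Sum>i | i < length I \<and> f i = b. sz (I ! i)) \<le> 1)"

lemma OPT_eq: "OPT I = (LEAST k. \<exists>f. offline_packing I k f)"
  unfolding OPT_def offline_packing_def ..

section \<open>From explicit lists of bins to upper bounds on the optimum\<close>

text \<open>The sum over \<open>zip I ys\<close> depends only on the multiset of pairs, so in this
  form bin loads survive a reordering of the items.\<close>

lemma sum_zip_filter:
  assumes "length ys = length I"
  shows "(\<Sum>i | i < length I \<and> ys ! i = b. sz (I ! i))
    = (\<Sum>p\<leftarrow>zip I ys. if snd p = b then sz (fst p) else 0)"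
proof -
  have "(\<Sum>p\<leftarrow>zip I ys. if snd p = b then sz (fst p) else 0)
      = (\<Sum>i<length I. if ys ! i = b then sz (I ! i) else 0)"
    using assms by (auto simp: sum_list_sum_nth atLeast0LessThan intro!: sum.cong)
  also have "\<dots> = (\<Sum>i | i < length I \<and> ys ! i = b. sz (I ! i))"
    by (simp flip: sum.inter_filter)
  finally show ?thesis by simp
qed

text \<open>Label every item with the index of its bin. The value 0 for labels beyond
  \<open>length Bs\<close> is what lets the induction append a bin with a fresh label.\<close>

lemma labelled_bins:
  "\<exists>ys. length ys = length (concat Bs) \<and> set ys \<subseteq> {..<length Bs} \<and>
    (\<forall>b. (\<Sum>p\<leftarrow>zip (concat Bs) ys. if snd p = b then sz (fst p) else 0)
      = (if b < length Bs then load (Bs ! b) else 0))"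
proof (induction Bs rule: rev_induct)
  case Nil
  then show ?case by simp
next
  case (snoc B Bs)
  then obtain ys where ys: "length ys = length (concat Bs)" "set ys \<subseteq> {..<length Bs}"
    "\<And>b. (\<Sum>p\<leftarrow>zip (concat Bs) ys. if snd p = b then sz (fst p) else 0)
      = (if b < length Bs then load (Bs ! b) else 0)"
    by blast
  have B: "(\<Sum>p\<leftarrow>zip B (replicate (length B) n). if snd p = b then sz (fst p) else 0)
    = (if b = n then load B else 0)" for b n
    unfolding load_def by (induction B) auto
  let ?zs = "ys @ replicate (length B) (length Bs)"
  have "length ?zs = length (concat (Bs @ [B]))" using ys(1) by simp
  moreover have "set ?zs \<subseteq> {..<length (Bs @ [B])}" using ys(2) by auto
  moreover have "(\<Sum>p\<leftarrow>zip (concat (Bs @ [B])) ?zs. if snd p = b then sz (fst p) else 0)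
      = (if b < length (Bs @ [B]) then load ((Bs @ [B]) ! b) else 0)" for b
    using ys(1) by (auto simp: ys(3) B nth_append)
  ultimately show ?case by blast
qed

lemma offline_packing_of_bins:
  assumes "mset I = mset (concat Bs)" and "\<And>B. B \<in> set Bs \<Longrightarrow> load B \<le> 1"
  shows "\<exists>f. offline_packing I (length Bs) f"
proof -
  obtain ys where ys: "length ys = length (concat Bs)" "set ys \<subseteq> {..<length Bs}"
    "\<And>b. (\<Sum>p\<leftarrow>zip (concat Bs) ys. if snd p = b then sz (fst p) else 0)
      = (if b < length Bs then load (Bs ! b) else 0)"
    using labelled_bins[of Bs] by blast
  \<comment> \<open>The labels follow their items through the permutation that turns
    \<open>concat Bs\<close> into \<open>I\<close>.\<close>
  obtain zs where zs: "length zs = length I" "mset (zip I zs) = mset (zip (concat Bs) ys)"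
    using ex_mset_zip_left[OF ys(1)[symmetric] assms(1)] by blast
  have "mset zs = mset ys"
    using arg_cong[OF zs(2), of "image_mset snd"] zs(1) ys(1) by (simp flip: mset_map)
  then have "set zs \<subseteq> {..<length Bs}" using ys(2) mset_eq_setD by blast
  then have "\<forall>i<length I. zs ! i < length Bs" using zs(1) by (metis lessThan_iff nth_mem subsetD)
  moreover have "(\<Sum>i | i < length I \<and> zs ! i = b. sz (I ! i)) \<le> 1" if "b < length Bs" for b
  proof -
    have "(\<Sum>i | i < length I \<and> zs ! i = b. sz (I ! i))
      = (\<Sum>p\<in>#mset (zip I zs). if snd p = b then sz (fst p) else 0)"
      unfolding sum_zip_filter[OF zs(1)] by (simp flip: sum_mset_sum_list)
    also have "\<dots> = (\<Sum>p\<leftarrow>zip (concat Bs) ys. if snd p = b then sz (fst p) else 0)"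
      unfolding zs(2) by (simp flip: sum_mset_sum_list)
    finally show ?thesis using ys(3) assms(2) that by simp
  qed
  ultimately show ?thesis unfolding offline_packing_def by (intro exI[of _ "\<lambda>i. zs ! i"]) auto
qed

lemma OPT_le:
  assumes "mset I = mset (concat Bs)" and "\<And>B. B \<in> set Bs \<Longrightarrow> load B \<le> 1"
  shows "OPT I \<le> length Bs"
  unfolding OPT_eq using offline_packing_of_bins[OF assms] by (rule Least_le)

text \<open>Volume bound: each item has size at least \<open>2^-j\<close>, so a bin holds at most
  \<open>2 ^ j\<close> of them. Long instances therefore have a large optimum.\<close>

lemma length_le_OPT:
  assumes "valid_instance m j I"
  shows "length I \<le> OPT I * 2 ^ j"
proof -
  have sz: "eps j \<le> sz e" "sz e \<le> 1" if "e \<in> set I" for e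
    using assms that unfolding valid_instance_def by auto
  \<comment> \<open>One bin per item shows that packings exist, so the minimum is attained.\<close>
  have "\<exists>f. offline_packing I (length (map (\<lambda>e. [e]) I)) f"
    by (rule offline_packing_of_bins) (auto simp: load_def sz)
  then have "\<exists>f. offline_packing I (OPT I) f" unfolding OPT_eq by (rule LeastI)
  then obtain f where f: "\<And>i. i < length I \<Longrightarrow> f i < OPT I"
    "\<And>b. b < OPT I \<Longrightarrow> (\<Sum>i | i < length I \<and> f i = b. sz (I ! i)) \<le> 1"
    unfolding offline_packing_def by blast
  have "real (length I) * eps j = (\<Sum>i<length I. eps j)" by simp
  also have "\<dots> \<le> (\<Sum>i<length I. sz (I ! i))" by (intro sum_mono) (simp add: sz)
  also have "\<dots> = (\<Sum>b<OPT I. \<Sum>i | i \<in> {..<length I} \<and> f i = b. sz (I ! i))"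
    by (rule sum.group[symmetric]) (use f(1) in auto)
  also have "\<dots> \<le> (\<Sum>b<OPT I. 1)" using f(2) by (intro sum_mono) auto
  finally have "real (length I) \<le> real (OPT I) * 2 ^ j" by (simp add: eps_def field_simps)
  then have "real (length I) \<le> real (OPT I * 2 ^ j)" by simp
  then show ?thesis by (simp only: of_nat_le_iff)
qed

section \<open>Non-isolated bins\<close>

text \<open>Forgets which bin holds a region. What is left still determines the level of a colour
  and suffices to refute that an item fits.\<close>

definition level_regions :: "state \<Rightarrow> (nat \<times> region) set" where
  "level_regions S = (\<Union>b\<in>set (bins S). Pair (lev b) ` set (regs b))"

lemma level_regions_iff:
  "(l, R) \<in> level_regions S \<longleftrightarrow> (\<exists>b\<in>set (bins S). lev b = l \<and> R \<in> set (regs b))"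
  unfolding level_regions_def by auto

text \<open>The space reserved by the regions in use, in units of \<open>eps j\<close>.\<close>

definition reserved :: "state \<Rightarrow> nat" where
  "reserved S = (\<Sum>b\<leftarrow>bins S. length (regs b) * 2 ^ lev b)"

text \<open>The bound \<open>2 ^ (j - lev b)\<close> on the number of regions, multiplied out so
  that it compares directly with \<open>reserved\<close>.\<close>

definition capacity_ok :: "nat \<Rightarrow> state \<Rightarrow> bool" where
  "capacity_ok j S \<longleftrightarrow> (\<forall>b\<in>set (bins S). length (regs b) * 2 ^ lev b \<le> 2 ^ j)"

text \<open>A bin offers \<open>2 ^ j\<close> units, so reserved space bounds the number of bins
  from below, however the regions are spread.\<close>

lemma reserved_le_bins:
  assumes "capacity_ok j S"
  shows "reserved S \<le> length (bins S) * 2 ^ j"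
  using assms sum_list_mono[of "bins S" "\<lambda>b. length (regs b) * 2 ^ lev b" "\<lambda>_. 2 ^ j"]
  unfolding reserved_def capacity_ok_def by (simp add: sum_list_triv)

section \<open>Effect of opening a region\<close>

lemma new_region_cases:
  obtains (old) b B where "b < length (bins S)" "B = bins S ! b" "lev B = l"
      "length (regs B) < 2 ^ (j - l)"
      "new_region j S e l = S\<lparr>bins := (bins S)[b := B\<lparr>regs := regs B @ [[e]]\<rparr>]\<rparr>"
  | (new) "new_region j S e l = S\<lparr>bins := bins S @ [\<lparr>lev = l, regs = [[e]]\<rparr>]\<rparr>"
proof (cases "\<exists>b. b < length (bins S) \<and> lev (bins S ! b) = l \<and>
                      length (regs (bins S ! b)) < 2 ^ (j - l)")
  case True
  from LeastI_ex[OF True] show ?thesis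
    using True by (intro old[OF _ refl]) (auto simp: new_region_def Let_def)
next
  case False
  then show ?thesis by (intro new) (auto simp: new_region_def Let_def)
qed

lemma level_regions_new_region:
  "level_regions (new_region j S e l) = insert (l, [e]) (level_regions S)"
proof (cases rule: new_region_cases[of S l j e])
  case (old b B)
  let ?B = "B\<lparr>regs := regs B @ [[e]]\<rparr>"
  \<comment> \<open>Splitting at \<open>b\<close> copes with equal bins at other indices: the
    extended bin keeps all regions of \<open>B\<close>, so the union only gains the new one.\<close>
  have S: "bins S = take b (bins S) @ B # drop (Suc b) (bins S)"
    using old by (simp add: id_take_nth_drop)
  have "set ((bins S)[b := ?B]) = insert ?B (set (take b (bins S)) \<union> set (drop (Suc b) (bins S)))"
    using old by (simp add: upd_conv_take_nth_drop)
  moreover have "set (bins S) = insert B (set (take b (bins S)) \<union> set (drop (Suc b) (bins S)))"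
    using arg_cong[OF S, of set] by simp
  ultimately show ?thesis using old(3,5) unfolding level_regions_def by auto
next
  case new
  then show ?thesis unfolding level_regions_def by auto
qed

lemma reserved_new_region: "reserved (new_region j S e l) = reserved S + 2 ^ l"
proof (cases rule: new_region_cases[of S l j e])
  case (old b B)
  have S: "bins S = take b (bins S) @ B # drop (Suc b) (bins S)"
    using old by (simp add: id_take_nth_drop)
  have "reserved S = (\<Sum>b\<leftarrow>take b (bins S) @ B # drop (Suc b) (bins S). length (regs b) * 2 ^ lev b)"
    unfolding reserved_def by (subst S) simp
  then show ?thesis using old unfolding reserved_def by (simp add: upd_conv_take_nth_drop)
next
  case new
  then show ?thesis unfolding reserved_def by simp
qed

lemma capacity_ok_new_region:
  assumes "capacity_ok j S" "l \<le> j"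
  shows "capacity_ok j (new_region j S e l)"
proof -
  have pow: "(2::nat) ^ (j - l) * 2 ^ l = 2 ^ j" using assms(2) by (simp flip: power_add)
  show ?thesis
  proof (cases rule: new_region_cases[of S l j e])
    case (old b B)
    have "Suc (length (regs B)) * 2 ^ l \<le> 2 ^ (j - l) * (2::nat) ^ l"
      using old(4) by (intro mult_right_mono) auto
    then show ?thesis
      using old assms(1) pow unfolding capacity_ok_def by (auto dest!: set_update_subset_insert[THEN subsetD])
  next
    case new
    then show ?thesis using assms unfolding capacity_ok_def by (auto intro: power_increasing)
  qed
qed

lemma colour_level_eq:
  "colour_level S c = Max (insert 0 {l. \<exists>R. (l, R) \<in> level_regions S \<and> c \<in> col ` set R})"
proof -
  have cc: "contains_colour b c \<longleftrightarrow> (\<exists>R\<in>set (regs b). c \<in> col ` set R)" for b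
    unfolding contains_colour_def image_iff by metis
  have "lev ` {b \<in> set (bins S). contains_colour b c}
      = {l. \<exists>R. (l, R) \<in> level_regions S \<and> c \<in> col ` set R}"
    unfolding cc level_regions_iff by blast
  then show ?thesis unfolding colour_level_def by simp
qed

text \<open>Serves to refute fitting: if no listed region of the colour has room, the item fits at
  no level.\<close>

lemma fits_levelD:
  assumes "fits_level j S e i"
  shows "\<exists>R. (i, R) \<in> level_regions S \<and> col e \<in> col ` set R \<and> load R + sz e \<le> 2 ^ i * eps j"
proof -
  obtain b r where br: "fits_in j S e i (b, r)" using assms unfolding fits_level_def by auto
  then have "(i, regs (bins S ! b) ! r) \<in> level_regions S"
    unfolding fits_in_def level_regions_iff by (auto intro!: bexI[of _ "bins S ! b"])
  with br show ?thesis unfolding fits_in_def by (intro exI[of _ "regs (bins S ! b) ! r"]) (auto simp: image_iff eq_commute)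
qed

text \<open>MNF and MFF agree here: when nothing fits, both start from the level of the colour. With
  \<open>l \<noteq> j\<close> no isolated bin is opened.\<close>

lemma pack_item_new_region:
  assumes "colour_level S (col e) < j" "\<And>i. \<not> fits_level j S e i"
    and "(LEAST l. colour_level S (col e) < l \<and> sz e \<le> 2 ^ l * eps j) = l" "l \<noteq> j"
  shows "pack_item v j S e = new_region j S e l"
proof -
  have "start_level v j S e = colour_level S (col e)" using assms(2) by (cases v) auto
  then show ?thesis using assms unfolding pack_item_def pack_non_isolated_def by (simp add: Let_def)
qed

section \<open>The factor 3\<close>

text \<open>The excess \<epsilon> squared keeps the second item out of the region of size
  2\<epsilon> opened by the first. \<open>Suc c\<close> turns indices from 0 into colours from
  1.\<close>

definition colour_pair :: "nat \<Rightarrow> nat \<Rightarrow> item list" where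
  "colour_pair j c = [\<lparr>sz = eps j, col = Suc c\<rparr>, \<lparr>sz = eps j + (eps j)\<^sup>2, col = Suc c\<rparr>]"

definition sparse_instance :: "nat \<Rightarrow> nat \<Rightarrow> item list" where
  "sparse_instance j n = concat (map (colour_pair j) [0..<n])"

lemma eps_pos: "eps j > 0"
  unfolding eps_def by simp

lemma eps_le: "3 \<le> j \<Longrightarrow> eps j \<le> 1 / 8"
  using power_increasing[of 3 j "2::real"] unfolding eps_def by (simp add: field_simps)

text \<open>A fresh colour has level 0, so its first item opens a level 1 region with only
  \<epsilon> left; the second exceeds that and moves to level 2. As \<open>j \<ge> 3\<close>, both
  levels are non-isolated.\<close>

lemma packing_colour_pair:
  assumes "3 \<le> j" and fresh: "\<And>l R. (l, R) \<in> level_regions S \<Longrightarrow> Suc c \<notin> col ` set R"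
  defines "e \<equiv> \<lparr>sz = eps j, col = Suc c\<rparr>" and "e' \<equiv> \<lparr>sz = eps j + (eps j)\<^sup>2, col = Suc c\<rparr>"
  shows "foldl (pack_item v j) S (colour_pair j c) = new_region j (new_region j S e 1) e' 2"
proof -
  have eps: "eps j > 0" "eps j \<le> 1" using eps_pos[of j] eps_le[OF assms(1)] by linarith+
  have none: "\<not> ((l, R) \<in> level_regions S \<and> Suc c \<in> col ` set R)" for l R
    using fresh[of l R] by simp
  have "colour_level S (Suc c) = 0" by (simp only: colour_level_eq none) simp
  moreover have "\<not> fits_level j S e i" for i
    using fits_levelD[of j S e i] none by (auto simp: e_def)
  moreover have "(LEAST l. 0 < l \<and> sz e \<le> 2 ^ l * eps j) = 1"
    using eps by (intro Least_equality) (auto simp: e_def)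
  ultimately have 1: "pack_item v j S e = new_region j S e 1"
    using assms(1) by (intro pack_item_new_region) (auto simp: e_def)
  let ?T = "new_region j S e 1"
  have reg: "(i, R) \<in> level_regions ?T \<and> Suc c \<in> col ` set R \<longleftrightarrow> i = 1 \<and> R = [e]" for i R
    using fresh unfolding level_regions_new_region by (auto simp: e_def)
  have "{l. \<exists>R. (l, R) \<in> level_regions ?T \<and> Suc c \<in> col ` set R} = {1}"
    by (simp only: reg) simp
  then have "colour_level ?T (Suc c) = 1" by (simp only: colour_level_eq) simp
  moreover have "\<not> fits_level j ?T e' i" for i
  proof
    assume "fits_level j ?T e' i"
    then obtain R where R: "(i, R) \<in> level_regions ?T" "col e' \<in> col ` set R"
      "load R + sz e' \<le> 2 ^ i * eps j"
      using fits_levelD by blast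
    then have "i = 1 \<and> R = [e]" using reg[of i R] by (simp add: e'_def)
    with R(3) show False using eps by (simp add: e'_def e_def load_def)
  qed
  moreover have "(LEAST l. 1 < l \<and> sz e' \<le> 2 ^ l * eps j) = 2"
  proof (rule Least_equality)
    have "eps j * eps j \<le> eps j * 1" using eps by (intro mult_left_mono) auto
    then show "1 < (2::nat) \<and> sz e' \<le> 2 ^ 2 * eps j"
      using eps by (simp add: e'_def power2_eq_square)
  qed auto
  ultimately have 2: "pack_item v j ?T e' = new_region j ?T e' 2"
    using assms(1) by (intro pack_item_new_region) (auto simp: e'_def)
  show ?thesis using 1 2 unfolding colour_pair_def e_def e'_def by simp
qed

text \<open>Each colour reserves 2 + 4 = 6 units. The third conjunct keeps colour
  \<open>Suc n\<close> fresh for the next step.\<close>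

lemma packing_sparse_instance:
  fixes v :: variant
  assumes "3 \<le> j"
  defines "S \<equiv> \<lambda>n. packing v j (sparse_instance j n)"
  shows "reserved (S n) = 6 * n \<and> capacity_ok j (S n) \<and>
    (\<forall>(l, R)\<in>level_regions (S n). col ` set R \<subseteq> {1..n})"
proof (induction n)
  case 0
  then show ?case
    by (simp add: S_def packing_def sparse_instance_def empty_state_def reserved_def
        capacity_ok_def level_regions_def)
next
  case (Suc n)
  have "S (Suc n) = foldl (pack_item v j) (S n) (colour_pair j n)"
    unfolding S_def packing_def sparse_instance_def by simp
  also have "\<dots> = new_region j (new_region j (S n) \<lparr>sz = eps j, col = Suc n\<rparr> 1)
      \<lparr>sz = eps j + (eps j)\<^sup>2, col = Suc n\<rparr> 2"
    using Suc by (intro packing_colour_pair assms(1)) force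
  finally show ?case
    using Suc assms(1)
    by (fastforce simp: reserved_new_region level_regions_new_region intro!: capacity_ok_new_region)
qed

lemma bins_used_sparse_instance:
  assumes "3 \<le> j"
  shows "6 * n \<le> bins_used v j (sparse_instance j n) * 2 ^ j"
  using packing_sparse_instance[OF assms, of v n] reserved_le_bins unfolding bins_used_def by metis

section \<open>Offline cost of the sparse instance\<close>

lemma sparse_instance_chunks:
  "sparse_instance j (h * k)
    = concat (map (\<lambda>b. concat (map (colour_pair j) [h * b..<h * b + h])) [0..<k])"
proof (induction k)
  case 0
  then show ?case by (simp add: sparse_instance_def)
next
  case (Suc k)
  have "[0..<h * Suc k] = [0..<h * k] @ [h * k..<h * k + h]"
    using upt_add_eq_append[of 0 "h * k" h] by (simp add: algebra_simps)
  with Suc show ?case by (simp add: sparse_instance_def)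
qed

lemma load_colour_pairs:
  "load (concat (map (colour_pair j) xs)) = length xs * (2 * eps j + (eps j)\<^sup>2)"
  by (induction xs) (auto simp: load_def colour_pair_def algebra_simps)

text \<open>Without the squares, \<open>2 ^ (j - 1)\<close> pairs would fill a bin exactly. Leaving
  one pair out frees 2\<epsilon>, while the fewer than 1 / (2\<epsilon>) squares add less than
  \<epsilon> / 2.\<close>

lemma OPT_sparse_instance:
  assumes "h = 2 ^ (j - 1) - 1" "3 \<le> j"
  shows "OPT (sparse_instance j (h * k)) \<le> k"
proof -
  let ?Bs = "map (\<lambda>b. concat (map (colour_pair j) [h * b..<h * b + h])) [0..<k]"
  have j: "2 ^ j = (2::real) * 2 ^ (j - 1)" using assms(2) by (cases j) auto
  have h: "real h = 2 ^ (j - 1) - 1" unfolding assms(1) by (simp add: of_nat_diff)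
  have "real h * (2 * eps j + (eps j)\<^sup>2) \<le> 1"
  proof -
    define q where "q = (2::real) ^ (j - 1)"
    have "q > 0" unfolding q_def by simp
    have e: "eps j = 1 / (2 * q)" unfolding eps_def j q_def by simp
    have "(q - 1) * (2 * (1 / (2 * q)) + (1 / (2 * q))\<^sup>2) \<le> 1"
      using \<open>q > 0\<close> by (simp add: divide_simps power2_eq_square) (simp add: algebra_simps)
    then show ?thesis unfolding h e q_def[symmetric] .
  qed
  then have "OPT (sparse_instance j (h * k)) \<le> length ?Bs"
    by (intro OPT_le) (auto simp: sparse_instance_chunks load_colour_pairs)
  then show ?thesis by simp
qed

lemma valid_sparse_instance: "3 \<le> j \<Longrightarrow> valid_instance (max 1 n) j (sparse_instance j n)"
proof -
  assume "3 \<le> j"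
  then have e: "0 < eps j" "eps j \<le> 1 / 8" using eps_pos[of j] eps_le[of j] by auto
  then have "eps j * eps j \<le> eps j * 1" by (intro mult_left_mono) auto
  with e have "eps j + eps j * eps j \<le> 1" by linarith
  then show ?thesis
    using e by (auto simp: valid_instance_def sparse_instance_def colour_pair_def power2_eq_square)
qed

lemma length_sparse_instance: "length (sparse_instance j n) = 2 * n"
  by (induction n) (auto simp: sparse_instance_def colour_pair_def)

text \<open>The algorithm reserves \<open>6 * h * k\<close> units against at most \<open>k\<close>
  offline bins, a ratio of at least \<open>6 * h / 2 ^ j = 3 - 6 / 2 ^ j\<close>.\<close>

lemma factor_3:
  assumes "3 \<le> j" "6 / 2 ^ j \<le> \<delta>"
  shows "\<exists>m I. valid_instance m j I \<and> N \<le> OPT I \<and>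
    real (bins_used v j I) \<ge> (3 - \<delta>) * real (OPT I)"
proof -
  \<comment> \<open>The factor \<open>2 ^ j\<close> in \<open>k\<close> makes up for the one lost in
    \<open>length_le_OPT\<close>.\<close>
  define h k where "h = (2::nat) ^ (j - 1) - 1" and "k = N * 2 ^ j"
  let ?I = "sparse_instance j (h * k)"
  have val: "valid_instance (max 1 (h * k)) j ?I" using valid_sparse_instance[OF assms(1)] .
  have "(2::nat) ^ 2 \<le> 2 ^ (j - 1)" using assms(1) by (intro power_increasing) auto
  then have h1: "h \<ge> 1" unfolding h_def by simp
  have "N * 2 ^ j \<le> h * k" unfolding k_def using h1 by simp
  also have "\<dots> \<le> length ?I" by (simp add: length_sparse_instance)
  also have "\<dots> \<le> OPT ?I * 2 ^ j" by (rule length_le_OPT[OF val])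
  finally have N: "N \<le> OPT ?I" by simp
  have j: "2 ^ j = (2::real) * 2 ^ (j - 1)" using assms(1) by (cases j) auto
  have "(2::real) ^ 3 \<le> 2 ^ j" using assms(1) by (intro power_increasing) auto
  then have nonneg: "0 \<le> 3 - 6 / (2::real) ^ j" by (simp add: field_simps)
  \<comment> \<open>\<open>3 - \<delta>\<close> may be negative; its replacement is not, so the
    upper bound on \<open>OPT\<close> can be inserted next.\<close>
  have "(3 - \<delta>) * real (OPT ?I) \<le> (3 - 6 / 2 ^ j) * real (OPT ?I)"
    using assms(2) by (intro mult_right_mono) auto
  also have "\<dots> \<le> (3 - 6 / 2 ^ j) * real k"
    using OPT_sparse_instance[OF h_def assms(1), of k] nonneg by (intro mult_left_mono) auto
  also have "\<dots> = real (6 * (h * k)) / 2 ^ j"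
    unfolding h_def j by (simp add: of_nat_diff field_simps)
  also have "\<dots> \<le> real (bins_used v j ?I)"
  proof -
    have "real (6 * (h * k)) \<le> real (bins_used v j ?I * 2 ^ j)"
      using bins_used_sparse_instance[OF assms(1)] by (simp only: of_nat_le_iff)
    then show ?thesis by (simp add: field_simps)
  qed
  finally show ?thesis using val N by blast
qed

section \<open>Isolated bins\<close>

definition blocking :: "item list \<Rightarrow> item list \<Rightarrow> bool" where
  "blocking G H \<longleftrightarrow> (\<forall>e\<in>set H. load G + sz e > 1)"

text \<open>Having at least one bin puts \<open>c\<close> on level \<open>j\<close>, so every
  further item of \<open>c\<close> goes to Bounded Best-Fit.\<close>

definition isolated_state :: "nat \<Rightarrow> nat \<Rightarrow> state \<Rightarrow> bool" where
  "isolated_state j c S \<longleftrightarrow> bins S \<noteq> [] \<and> opens S c \<subseteq> {..<length (bins S)} \<and>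
    (\<forall>b\<in>set (bins S). lev b = j \<and> contains_colour b c)"

text \<open>Closed by lack of space only: these bins may still be open for the algorithm.\<close>

definition closed_for :: "nat \<Rightarrow> state \<Rightarrow> item list \<Rightarrow> bool" where
  "closed_for c S H \<longleftrightarrow> (\<forall>k\<in>opens S c. \<forall>e\<in>set H. bin_load (bins S ! k) + sz e > 1)"

section \<open>Bounded Best-Fit on groups that block each other\<close>

lemma pack_item_isolated:
  assumes "isolated_state j c S" "col e = c"
  shows "pack_item v j S e = pack_isolated j S e"
proof -
  obtain b where "b \<in> set (bins S)" using assms(1) unfolding isolated_state_def by (cases "bins S") auto
  then have "j \<le> colour_level S c"
    using assms(1) unfolding isolated_state_def colour_level_def by (intro Max_ge) force+
  then show ?thesis using assms(2) unfolding pack_item_def by simp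
qed

text \<open>The first item fits no open bin and opens one; for the rest of the group that bin is the
  only one with room. Whichever bin gets closed, the open ones are the new bin and some earlier
  ones.\<close>

lemma packing_group:
  fixes v :: variant
  assumes S: "isolated_state j c S" "closed_for c S (e # G)"
    and G: "\<forall>x\<in>set (e # G). col x = c \<and> 0 \<le> sz x" "load (e # G) \<le> 1"
  defines "T \<equiv> foldl (pack_item v j) S (e # G)"
  shows "bins T = bins S @ [\<lparr>lev = j, regs = [e # G]\<rparr>] \<and> length (bins S) \<in> opens T c \<and>
    opens T c \<subseteq> insert (length (bins S)) (opens S c)"
  using S G unfolding T_def
proof (induction G rule: rev_induct)
  case Nil
  let ?Op = "opens S c"
  have "{k \<in> ?Op. bin_load (bins S ! k) + sz e \<le> 1} = {}"
    using Nil unfolding closed_for_def by force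
  then show ?case
    using Nil pack_item_isolated[OF Nil(1), of e v]
    by (auto simp: pack_isolated_def Let_def split: if_splits)
next
  case (snoc x G)
  let ?n = "length (bins S)"
  define T where "T = foldl (pack_item v j) S (e # G)"
  have "0 \<le> sz x" using snoc.prems by simp
  then have "load (e # G) \<le> 1" using snoc.prems(4) by (simp add: load_def)
  with snoc have T: "bins T = bins S @ [\<lparr>lev = j, regs = [e # G]\<rparr>]" "?n \<in> opens T c"
    "opens T c \<subseteq> insert ?n (opens S c)"
    unfolding T_def closed_for_def by auto
  have c: "col x = c" using snoc.prems by simp
  have "opens S c \<subseteq> {..<?n}" using snoc.prems(1) unfolding isolated_state_def by simp
  then have "isolated_state j c T"
    using T snoc.prems(1,3) unfolding isolated_state_def contains_colour_def by fastforce
  then have "pack_item v j T x = pack_isolated j T x" using c by (rule pack_item_isolated)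
  moreover have fitting: "{k \<in> opens T c. bin_load (bins T ! k) + sz x \<le> 1} = {?n}"
  proof -
    have "\<not> bin_load (bins T ! k) + sz x \<le> 1" if "k \<in> opens S c" for k
    proof -
      have "k < ?n" using that \<open>opens S c \<subseteq> {..<?n}\<close> by auto
      then have "bins T ! k = bins S ! k" by (simp add: T nth_append)
      then show ?thesis using snoc.prems(2) that unfolding closed_for_def by force
    qed
    moreover have "bin_load (bins T ! ?n) + sz x \<le> 1"
      using snoc.prems(4) by (simp add: T bin_load_def load_def)
    ultimately show ?thesis using T(2,3) by blast
  qed
  \<comment> \<open>With a single candidate, the unspecified tie-breaking of \<open>ARG_MAX\<close>
    leaves no choice.\<close>
  moreover have best: "(ARG_MAX (\<lambda>k. bin_load (bins T ! k)) k. k \<in> {?n}) = ?n"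
    unfolding arg_max_def is_arg_max_def by (rule some_equality) auto
  ultimately have "pack_item v j T x = put x ?n 0 T"
    unfolding pack_isolated_def Let_def c fitting best by simp
  moreover have "foldl (pack_item v j) S (e # G @ [x]) = pack_item v j T x"
    unfolding T_def by simp
  ultimately show ?case using T by (simp add: put_def Let_def)
qed

text \<open>Every group costs exactly one bin. \<open>closed_for\<close> persists: the new bin is
  blocked for all later groups by \<open>sorted_wrt blocking\<close>, and the old bins already
  were.\<close>

lemma packing_groups:
  assumes "isolated_state j c S" "closed_for c S (concat Gs)" "sorted_wrt blocking Gs"
    and "\<forall>G\<in>set Gs. G \<noteq> [] \<and> load G \<le> 1 \<and> (\<forall>x\<in>set G. col x = c \<and> 0 \<le> sz x)"
  shows "isolated_state j c (foldl (pack_item v j) S (concat Gs)) \<and>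
    length (bins (foldl (pack_item v j) S (concat Gs))) = length (bins S) + length Gs"
  using assms
proof (induction Gs arbitrary: S)
  case Nil
  then show ?case by simp
next
  case (Cons G Gs)
  define T where "T = foldl (pack_item v j) S G"
  obtain e G' where G: "G = e # G'" using Cons.prems(4) by (cases G) auto
  have T: "bins T = bins S @ [\<lparr>lev = j, regs = [G]\<rparr>]" "length (bins S) \<in> opens T c"
    "opens T c \<subseteq> insert (length (bins S)) (opens S c)"
    using packing_group[of j c S e G' v] Cons.prems unfolding T_def G closed_for_def by auto
  have sub: "opens S c \<subseteq> {..<length (bins S)}" using Cons.prems(1) unfolding isolated_state_def by simp
  have "contains_colour \<lparr>lev = j, regs = [G]\<rparr> c"
    using Cons.prems(4) G unfolding contains_colour_def by auto
  moreover have "opens T c \<subseteq> {..<length (bins T)}" using sub T(1,3) by fastforce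
  ultimately have "isolated_state j c T"
    using T(1) Cons.prems(1) unfolding isolated_state_def by auto
  moreover have "closed_for c T (concat Gs)"
    unfolding closed_for_def
  proof (intro ballI)
    fix k x assume k: "k \<in> opens T c" and x: "x \<in> set (concat Gs)"
    show "bin_load (bins T ! k) + sz x > 1"
    proof (cases "k = length (bins S)")
      case True
      then show ?thesis
        using x Cons.prems(3) by (auto simp: T bin_load_def blocking_def)
    next
      case False
      then have "k \<in> opens S c" using k T(3) by auto
      moreover from this have "bins T ! k = bins S ! k" using sub by (auto simp: T nth_append)
      ultimately show ?thesis using x Cons.prems(2) unfolding closed_for_def by auto
    qed
  qed
  ultimately show ?case
    using Cons.IH[of T] Cons.prems T(1) unfolding T_def by simp
qed

text \<open>Only level \<open>j\<close> has regions of size 1, so the item skips all lower levels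
  and its bin is at once the first open isolated bin.\<close>

lemma packing_full_item:
  assumes "1 \<le> j" "sz e = 1"
  shows "packing v j [e] = \<lparr>bins = [\<lparr>lev = j, regs = [[e]]\<rparr>],
    opens = (\<lambda>_. {})(col e := {0})\<rparr>"
proof -
  have "(LEAST l. 0 < l \<and> 1 \<le> 2 ^ l * eps j) = j"
  proof (rule Least_equality)
    show "0 < j \<and> 1 \<le> 2 ^ j * eps j" using assms by (simp add: eps_def)
  next
    fix l assume "0 < l \<and> 1 \<le> 2 ^ l * eps j"
    then have "(2::real) ^ j \<le> 2 ^ l" by (simp add: eps_def field_simps)
    then show "j \<le> l" by (rule power_le_imp_le_exp[rotated]) simp
  qed
  moreover have none: "\<not> fits_level j empty_state e i" for i
    unfolding fits_level_def fits_in_def empty_state_def by auto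
  moreover have level: "colour_level empty_state c = 0" for c
    unfolding colour_level_def empty_state_def by simp
  moreover have "start_level v j empty_state e = 0" by (cases v) (auto simp: none level)
  ultimately have "packing v j [e] =
      (new_region j empty_state e j)\<lparr>opens := (opens empty_state)(col e := {length (bins empty_state)})\<rparr>"
    using assms unfolding packing_def pack_item_def pack_non_isolated_def by simp
  then show ?thesis by (simp add: new_region_def empty_state_def)
qed

text \<open>The full item's bin admits no item of positive size, so \<open>packing_groups\<close>
  applies from there; the \<open>Suc\<close> counts this bin.\<close>

lemma bins_used_colour_groups:
  assumes "1 \<le> j" "sz e = 1" "col e = c" "sorted_wrt blocking Gs"
    and "\<forall>G\<in>set Gs. G \<noteq> [] \<and> load G \<le> 1 \<and> (\<forall>x\<in>set G. col x = c \<and> 0 < sz x)"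
  shows "bins_used_colour v j c (e # concat Gs) = Suc (length Gs)"
proof -
  let ?S = "packing v j [e]"
  let ?T = "foldl (pack_item v j) ?S (concat Gs)"
  have S: "?S = \<lparr>bins = [\<lparr>lev = j, regs = [[e]]\<rparr>], opens = (\<lambda>_. {})(col e := {0})\<rparr>"
    using packing_full_item[OF assms(1,2)] .
  have "isolated_state j c ?S" unfolding S isolated_state_def contains_colour_def by (simp add: assms)
  moreover have "closed_for c ?S (concat Gs)"
    using assms unfolding S closed_for_def by (auto simp: bin_load_def load_def)
  ultimately have T: "isolated_state j c ?T" "length (bins ?T) = Suc (length Gs)"
    using packing_groups[of j c ?S Gs v] assms by (auto simp: S less_imp_le)
  have "packing v j (e # concat Gs) = ?T" unfolding packing_def by simp
  moreover have "{b. b < length (bins ?T) \<and> contains_colour (bins ?T ! b) c} = {..<length (bins ?T)}"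
    using T(1) unfolding isolated_state_def by auto
  ultimately show ?thesis using T(2) unfolding bins_used_colour_def by simp
qed

section \<open>The factor 1.7\<close>

text \<open>The groups have loads above 5/6 and 2/3, with an excess beating all later deficits (the scales
  decrease geometrically for this reason); on the other hand
  \<open>small_pos i\<close> with \<open>med_neg i\<close>, \<open>small_neg i\<close> with \<open>med i\<close>, and \<open>small_neg i\<close> with
  \<open>med_pos (Suc i)\<close> leave room for \<open>large\<close>.\<close>

definition scale :: "nat \<Rightarrow> real" where
  "scale i = (1 / 16) ^ (i + 2)"

definition item1 :: "real \<Rightarrow> item" where
  "item1 x = \<lparr>sz = x, col = 1\<rparr>"

definition "small_pos i = item1 (1 / 6 + 6 * scale i)"
definition "small_neg i = item1 (1 / 6 - scale i)"
definition "med_pos i = item1 (1 / 3 + 15 * scale i)"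
definition "med_neg i = item1 (1 / 3 - 7 * scale i)"
definition "med i = item1 (1 / 3 + scale i / 2)"
definition "large k = item1 (1 / 2 + scale k)"

lemmas item1_defs = small_pos_def small_neg_def med_pos_def med_neg_def med_def large_def item1_def

definition small_groups :: "nat \<Rightarrow> item list list" where
  "small_groups i = replicate 2 (small_pos i # replicate 4 (small_neg i))"

definition med_groups :: "nat \<Rightarrow> item list list" where
  "med_groups i = replicate 2 [med_pos i, med_neg i] @ replicate 3 [med i, med i]"

definition groups :: "nat \<Rightarrow> item list list" where
  "groups k = concat (map small_groups [0..<k]) @ concat (map med_groups [0..<k]) @
    [[med_pos k, med_pos k]] @ concat (map (\<lambda>_. replicate 10 [large k]) [0..<k])"

text \<open>The 10 offline bins of one index. \<open>med_pos\<close> is shifted by one because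
  \<open>small_neg i\<close> with \<open>med_pos i\<close> would exceed 1/2 by
  \<open>14 * scale i\<close>.\<close>

definition triples :: "item \<Rightarrow> nat \<Rightarrow> item list list" where
  "triples h i = replicate 2 [small_pos i, med_neg i, h] @ replicate 6 [small_neg i, med i, h] @
    replicate 2 [small_neg i, med_pos (Suc i), h]"

lemma scale_bounds: "0 < scale i" "scale i \<le> 1 / 256"
proof -
  have "(1 / 16 :: real) ^ i \<le> 1" by (rule power_le_one) auto
  then show "scale i \<le> 1 / 256" by (simp add: scale_def power_add power2_eq_square)
qed (simp add: scale_def)

lemma scale_Suc: "scale (Suc i) = scale i / 16"
  by (simp add: scale_def)

lemma scale_less: "i < k \<Longrightarrow> scale k \<le> scale i / 16"
proof -
  assume "i < k"
  then have "(1 / 16 :: real) ^ (k + 2) \<le> (1 / 16) ^ (Suc i + 2)" by (intro power_decreasing) auto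
  then show ?thesis by (simp add: scale_def)
qed

lemma sorted_wrt_concat_map_upt:
  assumes "\<And>i. i < n \<Longrightarrow> sorted_wrt P (f i)"
    and "\<And>i k x y. i < k \<Longrightarrow> k < n \<Longrightarrow> x \<in> set (f i) \<Longrightarrow> y \<in> set (f k) \<Longrightarrow> P x y"
  shows "sorted_wrt P (concat (map f [0..<n]))"
  using assms by (induction n) (auto simp: sorted_wrt_append)

text \<open>A group has load \<open>5/6 + 2 * scale i\<close>, and a later small item falls short of
  1/6 by at most \<open>scale i\<close>.\<close>

lemma sorted_small: "sorted_wrt blocking (concat (map small_groups [0..<k]))"
proof (rule sorted_wrt_concat_map_upt)
  fix i
  show "sorted_wrt blocking (small_groups i)"
    using scale_bounds[of i]
    by (simp add: small_groups_def blocking_def load_def item1_defs numeral_eq_Suc)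
next
  fix i l :: nat and x y
  assume "i < l" "x \<in> set (small_groups i)" "y \<in> set (small_groups l)"
  then show "blocking x y"
    using scale_less[of i l] scale_bounds[of i] scale_bounds[of l]
    by (auto simp: small_groups_def blocking_def load_def item1_defs numeral_eq_Suc)
qed

text \<open>The excess \<open>8 * scale i\<close> of the mixed pairs beats the deficit
  \<open>7 * scale i\<close> of \<open>med_neg i\<close>. The pairs of \<open>med i\<close> come
  after these and have excess \<open>scale i\<close>, above \<open>7 * scale i / 16\<close>, the
  largest deficit at later indices.\<close>

lemma sorted_med: "sorted_wrt blocking (concat (map med_groups [0..<k]))"
proof (rule sorted_wrt_concat_map_upt)
  fix i
  show "sorted_wrt blocking (med_groups i)"
    using scale_bounds[of i]
    by (simp add: med_groups_def blocking_def load_def item1_defs numeral_eq_Suc)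
next
  fix i l :: nat and x y
  assume "i < l" "x \<in> set (med_groups i)" "y \<in> set (med_groups l)"
  then show "blocking x y"
    using scale_less[of i l] scale_bounds[of i] scale_bounds[of l]
    by (auto simp: med_groups_def blocking_def load_def item1_defs numeral_eq_Suc)
qed

lemma sorted_large: "sorted_wrt blocking (concat (map (\<lambda>_. replicate 10 [large k]) [0..<k]))"
  using scale_bounds[of k]
  by (intro sorted_wrt_concat_map_upt)
    (auto simp: blocking_def load_def item1_defs numeral_eq_Suc)

lemma load_small: "G \<in> set (small_groups i) \<Longrightarrow> load G > 5 / 6"
  using scale_bounds[of i] by (auto simp: small_groups_def load_def item1_defs numeral_eq_Suc)

lemma load_med: "G \<in> set (med_groups i) \<Longrightarrow> load G > 2 / 3"
  using scale_bounds[of i] by (auto simp: med_groups_def load_def item1_defs numeral_eq_Suc)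

lemma size_med: "G \<in> set (med_groups i) \<Longrightarrow> e \<in> set G \<Longrightarrow> sz e > 1 / 6"
  using scale_bounds[of i] by (auto simp: med_groups_def item1_defs numeral_eq_Suc)

text \<open>Across phases crude bounds suffice: load above 5/6 against sizes above 1/6, then load
  above 2/3 against sizes above 1/3.\<close>

lemma sorted_groups: "sorted_wrt blocking (groups k)"
proof -
  let ?S = "concat (map small_groups [0..<k])" and ?M = "concat (map med_groups [0..<k])"
    and ?U = "[[med_pos k, med_pos k]]" and ?L = "concat (map (\<lambda>_. replicate 10 [large k]) [0..<k])"
  have large: "sz e > 1 / 2" if "H \<in> set ?L" "e \<in> set H" for H e
    using that scale_bounds[of k] by (auto simp: item1_defs split: if_splits)
  have U: "sz e > 1 / 3" if "H \<in> set ?U" "e \<in> set H" for H e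
    using that scale_bounds[of k] by (auto simp: item1_defs)
  have S: "blocking G H" if "G \<in> set ?S" "H \<in> set (?M @ ?U @ ?L)" for G H
  proof -
    have "load G > 5 / 6" using that(1) load_small by auto
    moreover have "sz e > 1 / 6" if "e \<in> set H" for e
      using \<open>H \<in> set (?M @ ?U @ ?L)\<close> that large[of H e] U[of H e] size_med[of H _ e] by force
    ultimately show ?thesis unfolding blocking_def by fastforce
  qed
  have M: "blocking G H" if "G \<in> set ?M" "H \<in> set (?U @ ?L)" for G H
  proof -
    have "load G > 2 / 3" using that(1) load_med by auto
    moreover have "sz e > 1 / 3" if "e \<in> set H" for e
      using \<open>H \<in> set (?U @ ?L)\<close> that large[of H e] U[of H e] by force
    ultimately show ?thesis unfolding blocking_def by fastforce
  qed
  have L: "blocking [med_pos k, med_pos k] H" if "H \<in> set ?L" for H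
    using that scale_bounds[of k]
    by (auto simp: blocking_def load_def item1_defs split: if_splits)
  show ?thesis
    unfolding groups_def sorted_wrt_append
    using S M L sorted_small sorted_med sorted_large by (simp del: set_concat)
qed

text \<open>The size bound 1/8 is \<open>eps 3\<close>, which makes the instance valid for every
  \<open>j \<ge> 3\<close>.\<close>

lemma groups_ok:
  assumes "G \<in> set (groups k)"
  shows "G \<noteq> []" "load G \<le> 1" "\<And>e. e \<in> set G \<Longrightarrow> col e = 1 \<and> 1 / 8 \<le> sz e \<and> sz e \<le> 1"
proof -
  have "G \<noteq> [] \<and> load G \<le> 1 \<and> (\<forall>e\<in>set G. col e = 1 \<and> 1 / 8 \<le> sz e \<and> sz e \<le> 1)"
  proof -
    consider i where "G \<in> set (small_groups i)" | i where "G \<in> set (med_groups i)"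
      | "G = [med_pos k, med_pos k]" | "G = [large k]"
      using assms unfolding groups_def by (auto split: if_splits)
    then show ?thesis
    proof cases
      case (1 i)
      then show ?thesis using scale_bounds[of i]
        by (auto simp: small_groups_def load_def item1_defs numeral_eq_Suc)
    next
      case (2 i)
      then show ?thesis using scale_bounds[of i]
        by (auto simp: med_groups_def load_def item1_defs numeral_eq_Suc)
    next
      case 3
      then show ?thesis using scale_bounds[of k] by (auto simp: load_def item1_defs)
    next
      case 4
      then show ?thesis using scale_bounds[of k] by (auto simp: load_def item1_defs)
    qed
  qed
  then show "G \<noteq> []" "load G \<le> 1" "\<And>e. e \<in> set G \<Longrightarrow> col e = 1 \<and> 1 / 8 \<le> sz e \<and> sz e \<le> 1"
    by auto
qed

lemma length_concat_const:
  assumes "\<And>i. length (f i) = m"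
  shows "length (concat (map f [0..<k])) = m * k"
  using assms by (induction k) auto

lemma length_groups: "length (groups k) = 17 * k + 1"
proof -
  have "length (concat (map small_groups [0..<k])) = 2 * k"
    by (rule length_concat_const) (simp add: small_groups_def)
  moreover have "length (concat (map med_groups [0..<k])) = 5 * k"
    by (rule length_concat_const) (simp add: med_groups_def)
  moreover have "length (concat (map (\<lambda>_. replicate 10 [large k]) [0..<k])) = 10 * k"
    by (rule length_concat_const) simp
  ultimately show ?thesis unfolding groups_def by simp
qed

section \<open>Offline packing by triples\<close>

lemma length_triples: "length (concat (map (triples h) [0..<k])) = 10 * k"
  by (rule length_concat_const) (simp add: triples_def)

text \<open>The two smaller items fall short of 1/2 by \<open>scale i\<close>,
  \<open>scale i / 2\<close> and \<open>scale i / 16\<close> respectively. The last value is the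
  tight one: \<open>scale k \<le> scale i / 16\<close> is just what \<open>large k\<close>
  needs.\<close>

lemma load_triples:
  assumes "i < k"
  shows "B \<in> set (triples (large k) i) \<Longrightarrow> load B \<le> 1"
  using scale_bounds[of k] scale_bounds[of i] scale_less[OF assms]
  by (auto simp: triples_def load_def item1_defs scale_Suc numeral_eq_Suc)

text \<open>A telescoping sum: the shifted \<open>med_pos\<close> leaves one pair over at each end.
  The parameter \<open>h\<close> stays fixed during the induction, whereas \<open>large k\<close>
  would change.\<close>

lemma mset_triples:
  "mset (concat (concat (map small_groups [0..<k]))) + mset (concat (concat (map med_groups [0..<k])))
    + {#med_pos k, med_pos k#} + mset (concat (concat (map (\<lambda>_. replicate 10 [h]) [0..<k])))
   = {#med_pos 0, med_pos 0#} + mset (concat (concat (map (triples h) [0..<k])))"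
proof (induction k)
  case 0
  then show ?case by simp
next
  case (Suc k)
  \<comment> \<open>\<open>U\<close>, the spare pair at stage \<open>k\<close>, cancels against the
    pair that the balance of index \<open>k\<close> yields on its right side.\<close>
  have combine: "(A + a) + (B + b) + U' + (H + h) = V + (T + t)"
    if "A + B + U + H = V + T" "a + b + U' + h = U + t" for A a B b U U' H h V T t :: "item multiset"
  proof -
    have "(A + a) + (B + b) + U' + (H + h) = (A + B + H) + (a + b + U' + h)"
      by (simp only: add_ac)
    also have "\<dots> = (A + B + H) + (U + t)" by (simp only: that(2))
    also have "\<dots> = (A + B + U + H) + t" by (simp only: add_ac)
    also have "\<dots> = V + T + t" by (simp only: that(1))
    finally show ?thesis by (simp only: add.assoc)
  qed
  have "mset (concat (small_groups k)) + mset (concat (med_groups k)) +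
      {#med_pos (Suc k), med_pos (Suc k)#} + mset (concat (replicate 10 [h]))
    = {#med_pos k, med_pos k#} + mset (concat (triples h k))"
    by (simp add: small_groups_def med_groups_def triples_def numeral_eq_Suc)
  from combine[OF Suc this] show ?case
    by (simp only: upt_Suc_append map_append concat_append mset_append list.map concat.simps
        append_Nil2 le0)
qed

text \<open>Besides the triples, one bin holds the full item and one the leftover pair
  \<open>med_pos 0\<close>.\<close>

lemma OPT_groups: "OPT (item1 1 # concat (groups k)) \<le> 10 * k + 2"
proof -
  let ?Bs = "[[item1 1], [med_pos 0, med_pos 0]] @ concat (map (triples (large k)) [0..<k])"
  have "mset (item1 1 # concat (groups k)) = mset (concat ?Bs)"
    using mset_triples[of k "large k"] by (simp add: groups_def add_ac)
  moreover have "load B \<le> 1" if "B \<in> set ?Bs" for B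
    using that load_triples[of _ k B] scale_bounds[of 0] by (auto simp: load_def item1_defs)
  ultimately have "OPT (item1 1 # concat (groups k)) \<le> length ?Bs" by (rule OPT_le)
  then show ?thesis using length_triples[of "large k" k] by simp
qed

lemma length_le_length_concat: "[] \<notin> set xss \<Longrightarrow> length xss \<le> length (concat xss)"
  by (induction xss) (auto simp: Suc_le_eq add_strict_increasing length_greater_0_conv neq_Nil_conv)

section \<open>The ratio 1.7 and the union of both factors\<close>

lemma factor_17:
  assumes "3 \<le> j" "\<delta> > 0"
  shows "\<exists>m I. \<exists>c\<in>{1..m}. valid_instance m j I \<and> N \<le> OPT (items_of_colour c I) \<and>
    real (bins_used_colour v j c I) \<ge> (1.7 - \<delta>) * real (OPT (items_of_colour c I))"
proof -
  obtain k0 :: nat where k0: "1 / \<delta> \<le> real k0" using real_arch_simple by blast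
  define k where "k = max k0 (N * 2 ^ j)"
  let ?I = "item1 1 # concat (groups k)"
  have "1 / \<delta> \<le> real k" using k0 unfolding k_def by simp
  then have k: "1 \<le> \<delta> * real k" using assms(2) by (simp add: field_simps)
  have val: "valid_instance 1 j ?I"
    using groups_ok(3) eps_le[OF assms(1)] unfolding valid_instance_def
    by (fastforce simp: item1_def)
  have col: "items_of_colour 1 ?I = ?I"
    using val unfolding items_of_colour_def valid_instance_def by (auto intro: filter_True)
  have bins: "bins_used_colour v j 1 ?I = 17 * k + 2"
    using bins_used_colour_groups[of j "item1 1" 1 "groups k" v] sorted_groups groups_ok[of _ k]
      assms(1) by (force simp: item1_def length_groups)
  have "N * 2 ^ j \<le> k" unfolding k_def by simp
  also have "\<dots> \<le> length (groups k)" by (simp add: length_groups)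
  also have "\<dots> \<le> length ?I"
    using length_le_length_concat[of "groups k"] groups_ok(1) by fastforce
  also have "\<dots> \<le> OPT ?I * 2 ^ j" by (rule length_le_OPT[OF val])
  finally have N: "N \<le> OPT ?I" by simp
  have "(1.7 - \<delta>) * real (OPT ?I) \<le> 17 * real k + 2"
  \<comment> \<open>The upper bound on \<open>OPT\<close> can be multiplied in only if the factor is
    nonnegative. Then \<open>10 * \<delta> * k \<ge> 10\<close> absorbs the surplus 3.4 - 2; a
    negative factor is trivial.\<close>
  proof (cases "1.7 - \<delta> \<ge> 0")
    case True
    have "real (OPT ?I) \<le> real (10 * k + 2)" using OPT_groups[of k] by (simp only: of_nat_le_iff)
    then have "(1.7 - \<delta>) * real (OPT ?I) \<le> (1.7 - \<delta>) * (10 * real k + 2)"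
      using True by (intro mult_left_mono) auto
    also have "\<dots> = 17 * real k + 3.4 - 10 * (\<delta> * real k) - 2 * \<delta>" by (simp add: algebra_simps)
    also have "\<dots> \<le> 17 * real k + 2" using k assms(2) by simp
    finally show ?thesis .
  next
    case False
    then have "(1.7 - \<delta>) * real (OPT ?I) \<le> 0" by (intro mult_nonpos_nonneg) auto
    then show ?thesis by linarith
  qed
  then have "real (bins_used_colour v j 1 ?I) \<ge> (1.7 - \<delta>) * real (OPT ?I)"
    unfolding bins by simp
  with val N show ?thesis
    by (intro exI[of _ 1] exI[of _ ?I] bexI[of _ 1]) (simp_all only: col, simp_all)
qed

theorem theorem6:
  fixes v :: variant and \<delta> :: real
  assumes "\<delta> > 0"
  shows "\<exists>j\<ge>1.
    (\<forall>N. \<exists>m I. valid_instance m j I \<and> N \<le> OPT I \<and>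
        real (bins_used v j I) \<ge> (3 - \<delta>) * real (OPT I)) \<and>
    (\<forall>N. \<exists>m I. \<exists>c\<in>{1..m}. valid_instance m j I \<and> N \<le> OPT (items_of_colour c I) \<and>
        real (bins_used_colour v j c I) \<ge> (1.7 - \<delta>) * real (OPT (items_of_colour c I)))"
proof -
  obtain j0 :: nat where j0: "6 / \<delta> < 2 ^ j0" using real_arch_pow[of 2 "6 / \<delta>"] by auto
  \<comment> \<open>One \<open>j\<close> serves both claims: \<open>j0\<close> brings the loss
    \<open>6 / 2 ^ j\<close> below \<delta>, and 3 leaves levels 1 and 2 non-isolated and admits
    sizes from 1/8.\<close>
  define j where "j = max 3 j0"
  have "(2::real) ^ j0 \<le> 2 ^ j" unfolding j_def by (intro power_increasing) auto
  with j0 have "6 / \<delta> < 2 ^ j" by linarith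
  then have "6 / 2 ^ j \<le> \<delta>" using assms by (simp add: field_simps)
  moreover have "3 \<le> j" unfolding j_def by simp
  ultimately show ?thesis
    using factor_3 factor_17[OF _ assms] by (intro exI[of _ j]) simp
qed

end
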